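(* Let $m\ge 1$, let $T_i=(Q_i,q_i^0,\to_i,\Pi,L_i,w_i)$, $i=1,\dots,m$, be weighted transition systems with positive integer weights modelling a team of $m$ robots, let $\pi\in\Pi$, and let $\phi=\varphi\wedge \mathbf{G}\,\mathbf{F}\,\pi$, where $\varphi$ is an LTL formula over $\Pi$. Then the algorithm Multi-Robot-Optimal-Run (described in the context) solves the following problem: synthesize a run $r_i$ of $T_i$ for each $i=1,\dots,m$ such that the word generated by the team satisfies $\phi$ and the cost $J(\mathbb{T}^\pi)=\limsup_{k\to\infty}\big(\mathbb{T}^\pi(k+1)-\mathbb{T}^\pi(k)\big)$ is minimal among all tuples of runs of $T_1,\dots,T_m$ whose team word satisfies $\phi$. That is: let $r_R^\star$ be the run of the region automaton $R$ returned by the subroutine Optimal-Run, i.e. a run of $R$ that satisfies $\phi$ and minimizes $J(\mathbb{T}_R^\pi)$ among all runs of $R$ satisfying $\phi$, and let $r_i^\star$ be the projection of $r_R^\star$ onto $T_i$ for $i=1,\dots,m$. Then each $r_i^\star$ is a run of $T_i$, the word generated by the team following $(r_1^\star,\dots,r_m^\star)$ satisfies $\phi$, and for every tuple $(r_1,\dots,r_m)$ of runs of $T_1,\dots,T_m$ whose team word satisfies $\phi$, the cost $J$ of $(r_1^\star,\dots,r_m^\star)$ is at most the cost $J$ of $(r_1,\dots,r_m)$.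
   Context: **Transition systems.** A weighted transition system $T_i=(Q_i,q_i^0,\to_i,\Pi,L_i,w_i)$ consists of a finite set of states $Q_i$, an initial state $q_i^0\in Q_i$, a transition relation $\to_i\subseteq Q_i\times Q_i$, a finite set of atomic propositions $\Pi$ (common to all $i$), a labelling $L_i:Q_i\to 2^\Pi$, and weights $w_i$ assigning a positive integer to each transition ($w_i(a,b)$ is the time robot $i$ needs to go from $a$ to $b$; robots spend zero time at states). A run of $T_i$ is an infinite sequence $q_i^0q_i^1q_i^2\cdots$ starting at the initial state with $(q_i^k,q_i^{k+1})\in\to_i$ for all $k\ge 0$. LTL formulas over $\Pi$ are interpreted in the standard way over infinite words over $2^\Pi$; $\mathbf{G}$ is "always", $\mathbf{F}$ is "eventually". **Team behaviour.** Given runs $r_i=q_i^0q_i^1\cdots$ of $T_i$, let $t_i^0=0$ and $t_i^{k+1}=t_i^k+w_i(q_i^k,q_i^{k+1})$. Let $\mathbb{T}=t^0t^1\cdots$ be the set $\bigcup_{i=1}^m\{t_i^k:k\ge0\}$ listed in increasing order. The word generated by the team is $\omega=\omega^0\omega^1\cdots$ with $\omega^k=\bigcup\{L_i(q_i^j): 1\le i\le m,\ j\ge 0,\ t_i^j=t^k\}$. $\mathbb{T}^\pi(k)$ is the $k$-th time in $\mathbb{T}$ at which $\pi$ belongs to the corresponding letter of $\omega$. **Dual systems.** The dual $D_i$ of $T_i$ has states $ab$ for each $(a,b)\in\to_i$, together with one extra initial state $q^0_{D_i}$. Its transitions are $(ab,bc)$ for $(a,b),(b,c)\in\to_i$, and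 $(q^0_{D_i},q_i^0b)$ for $(q_i^0,b)\in\to_i$. A transition of $D_i$ with target $bc$ carries the label $L_i(b)$. Each state of $D_i$ has a duration: $c_i(ab)=w_i(a,b)$, $c_i(q^0_{D_i})=0$. **Region automaton $R$.** Robot $i$ has a clock $x_i$ measuring the time spent in the current state of $D_i$; it must leave a state as soon as the clock reaches the duration of that state (constraint $x_i\ge c_i$), at which moment the clock is reset to $0$. The states of $R$ are the pairs $\{q,v\}$, with $q=(q_1,\dots,q_m)$, $q_i$ a state of $D_i$, and $v=(v_1,\dots,v_m)$ a tuple of clock values, reachable from the initial state $\{(q^0_{D_1},\dots,q^0_{D_m}),(0,\dots,0)\}$ under the following transitions. Given $\{q,v\}$, let $\tau$ be the least $t\ge0$ such that $v_i+t\ge c_i(q_i)$ for some $i$, and $I=\{i: v_i+\tau\ge c_i(q_i)\}$. Then $\{q,v\}\to_R\{q',v'\}$ iff for $i\in I$, $(q_i,q_i')$ is a transition of $D_i$ and $v_i'=0$, and for $i\notin I$, $q_i'=q_i$ and $v_i'=v_i+\tau$. The weight of this transition is $\tau$, and the target state $\{q',v'\}$ is labelled by the union over $i\in I$ of the labels of the transitions $(q_i,q_i')$ of $D_i$. **Runs of $R$.** A run of $R$ is an infinite path from the initial state. The initial state only serves as a dummy start that is left at time $0$; the word $\omega_R$ of a run $r_R$ is the sequence of labels of its states after the dummy initial state, and $\mathbb{T}_R$ is the sequence of times (accumulated weights) at which these states are reached. $r_R$ satisfies $\phi$ if $\omega_R$ does. $\mathbb{T}_R^\pi(k)$ is the $k$-th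 time in $\mathbb{T}_R$ at which $\pi$ belongs to the corresponding letter of $\omega_R$, and $J(\mathbb{T}_R^\pi)=\limsup_{k\to\infty}(\mathbb{T}_R^\pi(k+1)-\mathbb{T}_R^\pi(k))$. **Projection.** The projection of a run $r_R$ onto $T_i$ is obtained by going through the states $\{q,v\}$ of $r_R$ after the dummy initial state, in order, and outputting, whenever $v_i=0$, the source vertex $a$ of the component $q_i=ab$ (nothing is output when $v_i\neq0$). **Algorithm Multi-Robot-Optimal-Run.** Input: $T_1,\dots,T_m$ and $\phi$. It constructs $D_1,\dots,D_m$ and then $R$; runs a known subroutine Optimal-Run, which returns a run $r_R^\star$ of $R$ that satisfies $\phi$ and minimizes $J(\mathbb{T}_R^\pi)$ among all runs of $R$ satisfying $\phi$; and outputs the projections $r_1^\star,\dots,r_m^\star$ of $r_R^\star$ onto $T_1,\dots,T_m$. *)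

theory Defs
  imports "HOL-Library.Extended_Real" "HOL-Library.Infinite_Set"
begin

section \<open>Weighted transition systems and LTL\<close>

record ('q, 'p) wts =
  states :: "'q set"
  initial :: 'q
  transitions :: "('q \<times> 'q) set"
  labelling :: "'q \<Rightarrow> 'p set"
  weight :: "'q \<Rightarrow> 'q \<Rightarrow> nat"

definition weighted_transition_system :: "'p set \<Rightarrow> ('q, 'p) wts \<Rightarrow> bool" where
  "weighted_transition_system AP T \<longleftrightarrow>
     finite (states T) \<and> initial T \<in> states T \<and>
     transitions T \<subseteq> states T \<times> states T \<and>
     finite AP \<and> (\<forall>q \<in> states T. labelling T q \<subseteq> AP) \<and>
     (\<forall>(a, b) \<in> transitions T. 0 < weight T a b)"

definition is_run :: "('q, 'p) wts \<Rightarrow> (nat \<Rightarrow> 'q) \<Rightarrow> bool" where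
  "is_run T r \<longleftrightarrow> r 0 = initial T \<and> (\<forall>k. (r k, r (Suc k)) \<in> transitions T)"

datatype (ltl_atoms: 'p) ltl =
    LTrue
  | LProp 'p
  | LNot "'p ltl"
  | LAnd "'p ltl" "'p ltl"
  | LNext "'p ltl"
  | LUntil "'p ltl" "'p ltl"

primrec ltl_sat :: "(nat \<Rightarrow> 'p set) \<Rightarrow> 'p ltl \<Rightarrow> bool" where
  "ltl_sat \<omega> LTrue \<longleftrightarrow> True"
| "ltl_sat \<omega> (LProp p) \<longleftrightarrow> p \<in> \<omega> 0"
| "ltl_sat \<omega> (LNot \<phi>) \<longleftrightarrow> \<not> ltl_sat \<omega> \<phi>"
| "ltl_sat \<omega> (LAnd \<phi> \<psi>) \<longleftrightarrow> ltl_sat \<omega> \<phi> \<and> ltl_sat \<omega> \<psi>"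
| "ltl_sat \<omega> (LNext \<phi>) \<longleftrightarrow> ltl_sat (\<lambda>n. \<omega> (n + 1)) \<phi>"
| "ltl_sat \<omega> (LUntil \<phi> \<psi>) \<longleftrightarrow>
     (\<exists>k. ltl_sat (\<lambda>n. \<omega> (n + k)) \<psi> \<and> (\<forall>j<k. ltl_sat (\<lambda>n. \<omega> (n + j)) \<phi>))"

definition LEventually :: "'p ltl \<Rightarrow> 'p ltl" where
  "LEventually \<phi> = LUntil LTrue \<phi>"

definition LAlways :: "'p ltl \<Rightarrow> 'p ltl" where
  "LAlways \<phi> = LNot (LEventually (LNot \<phi>))"


section \<open>The cost of a timed word\<close>

text \<open>If \<open>\<pi>\<close> belongs to infinitely many letters of \<open>\<omega>\<close>, \<^const>\<open>enumerate\<close> lists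
  their positions in increasing order. Otherwise \<open>hit_time\<close> and \<open>cost\<close> carry no meaning.\<close>

definition hit_time :: "'p \<Rightarrow> (nat \<Rightarrow> 'p set) \<Rightarrow> (nat \<Rightarrow> real) \<Rightarrow> nat \<Rightarrow> real" where
  "hit_time \<pi> \<omega> t k = t (enumerate {n. \<pi> \<in> \<omega> n} k)"

definition cost :: "'p \<Rightarrow> (nat \<Rightarrow> 'p set) \<Rightarrow> (nat \<Rightarrow> real) \<Rightarrow> ereal" where
  "cost \<pi> \<omega> t = limsup (\<lambda>k. ereal (hit_time \<pi> \<omega> t (Suc k) - hit_time \<pi> \<omega> t k))"


section \<open>Team behaviour\<close>

text \<open>Robots are indexed by a finite (hence nonempty) type \<open>'i\<close>. The state sets of the
  robots are arbitrary finite subsets of a common type \<open>'q\<close>.\<close>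

primrec arrival :: "('q, 'p) wts \<Rightarrow> (nat \<Rightarrow> 'q) \<Rightarrow> nat \<Rightarrow> nat" where
  "arrival T r 0 = 0"
| "arrival T r (Suc k) = arrival T r k + weight T (r k) (r (Suc k))"

definition team_time ::
  "('i::finite \<Rightarrow> ('q, 'p) wts) \<Rightarrow> ('i \<Rightarrow> nat \<Rightarrow> 'q) \<Rightarrow> nat \<Rightarrow> nat" where
  "team_time T r = enumerate (\<Union>i. range (arrival (T i) (r i)))"

definition team_word ::
  "('i::finite \<Rightarrow> ('q, 'p) wts) \<Rightarrow> ('i \<Rightarrow> nat \<Rightarrow> 'q) \<Rightarrow> nat \<Rightarrow> 'p set" where
  "team_word T r k =
     \<Union>{labelling (T i) (r i j) | i j. arrival (T i) (r i) j = team_time T r k}"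

definition team_cost ::
  "('i::finite \<Rightarrow> ('q, 'p) wts) \<Rightarrow> 'p \<Rightarrow> ('i \<Rightarrow> nat \<Rightarrow> 'q) \<Rightarrow> ereal" where
  "team_cost T \<pi> r = cost \<pi> (team_word T r) (\<lambda>k. real (team_time T r k))"


section \<open>Dual systems\<close>

datatype 'q dual_state = DInit | DEdge (source: 'q) (target: 'q)

text \<open>Transitions only connect elements of \<open>dual_states\<close>, so the reachable states of the region
  automaton below have all their components in these sets.\<close>

definition dual_states :: "('q, 'p) wts \<Rightarrow> 'q dual_state set" where
  "dual_states T = insert DInit {DEdge a b | a b. (a, b) \<in> transitions T}"

definition dual_transitions :: "('q, 'p) wts \<Rightarrow> ('q dual_state \<times> 'q dual_state) set" where
  "dual_transitions T =
     {(DEdge a b, DEdge b c) | a b c. (a, b) \<in> transitions T \<and> (b, c) \<in> transitions T} \<union>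
     {(DInit, DEdge (initial T) b) | b. (initial T, b) \<in> transitions T}"

text \<open>No transition has target \<^const>\<open>DInit\<close>, so that case is a dummy.\<close>

definition dual_label :: "('q, 'p) wts \<Rightarrow> 'q dual_state \<times> 'q dual_state \<Rightarrow> 'p set" where
  "dual_label T e = (case snd e of DInit \<Rightarrow> {} | DEdge b c \<Rightarrow> labelling T b)"

primrec duration :: "('q, 'p) wts \<Rightarrow> 'q dual_state \<Rightarrow> nat" where
  "duration T DInit = 0"
| "duration T (DEdge a b) = weight T a b"


section \<open>The region automaton\<close>

type_synonym ('i, 'q) region_state = "('i \<Rightarrow> 'q dual_state) \<times> ('i \<Rightarrow> real)"

definition region_initial :: "('i, 'q) region_state" where
  "region_initial = (\<lambda>i. DInit, \<lambda>i. 0)"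

definition region_delay ::
  "('i::finite \<Rightarrow> ('q, 'p) wts) \<Rightarrow> ('i, 'q) region_state \<Rightarrow> real" where
  "region_delay T = (\<lambda>(q, v). LEAST t. 0 \<le> t \<and> (\<exists>i. v i + t \<ge> real (duration (T i) (q i))))"

definition region_expired ::
  "('i::finite \<Rightarrow> ('q, 'p) wts) \<Rightarrow> ('i, 'q) region_state \<Rightarrow> 'i set" where
  "region_expired T =
     (\<lambda>(q, v). {i. v i + region_delay T (q, v) \<ge> real (duration (T i) (q i))})"

definition region_step ::
  "('i::finite \<Rightarrow> ('q, 'p) wts) \<Rightarrow> ('i, 'q) region_state \<Rightarrow> ('i, 'q) region_state \<Rightarrow> bool" where
  "region_step T = (\<lambda>(q, v) (q', v').
     (\<forall>i \<in> region_expired T (q, v).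
        (q i, q' i) \<in> dual_transitions (T i) \<and> v' i = 0) \<and>
     (\<forall>i. i \<notin> region_expired T (q, v) \<longrightarrow>
        q' i = q i \<and> v' i = v i + region_delay T (q, v)))"

inductive_set region_states ::
  "('i::finite \<Rightarrow> ('q, 'p) wts) \<Rightarrow> ('i, 'q) region_state set"
  for T :: "'i \<Rightarrow> ('q, 'p) wts" where
  init: "region_initial \<in> region_states T"
| step: "s \<in> region_states T \<Longrightarrow> region_step T s s' \<Longrightarrow> s' \<in> region_states T"

definition region_transitions ::
  "('i::finite \<Rightarrow> ('q, 'p) wts) \<Rightarrow> (('i, 'q) region_state \<times> ('i, 'q) region_state) set" where
  "region_transitions T = {(s, s'). s \<in> region_states T \<and> region_step T s s'}"

text \<open>The label that a transition puts on its target state. All transitions into a given state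
  agree on it (lemma \<open>region_label_eq\<close> below), so \<open>region_label\<close>, the union over all of them, is
  a well-defined state labelling.\<close>

definition region_step_label ::
  "('i::finite \<Rightarrow> ('q, 'p) wts) \<Rightarrow> ('i, 'q) region_state \<Rightarrow> ('i, 'q) region_state \<Rightarrow> 'p set" where
  "region_step_label T s s' =
     (\<Union>i \<in> region_expired T s. dual_label (T i) (fst s i, fst s' i))"

definition region_label ::
  "('i::finite \<Rightarrow> ('q, 'p) wts) \<Rightarrow> ('i, 'q) region_state \<Rightarrow> 'p set" where
  "region_label T s' = \<Union>{region_step_label T s s' | s. (s, s') \<in> region_transitions T}"

lemma region_delay_least:
  fixes T :: "'i::finite \<Rightarrow> ('q, 'p) wts"
  shows "0 \<le> region_delay T (q, v)"
    and "\<exists>i. v i + region_delay T (q, v) \<ge> real (duration (T i) (q i))"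
    and "0 \<le> t \<Longrightarrow> v i + t \<ge> real (duration (T i) (q i)) \<Longrightarrow> region_delay T (q, v) \<le> t"
proof -
  define P where "P t \<longleftrightarrow> 0 \<le> t \<and> (\<exists>i. v i + t \<ge> real (duration (T i) (q i)))" for t
  define d where "d i = real (duration (T i) (q i)) - v i" for i
  define \<tau> where "\<tau> = max 0 (Min (range d))"
  have "Min (range d) \<in> range d" by (intro Min_in) auto
  then obtain i0 where "Min (range d) = d i0" by (rule imageE)
  then have "d i0 \<le> \<tau>" unfolding \<tau>_def by simp
  then have P: "P \<tau>"
    unfolding P_def by (auto simp: d_def \<tau>_def intro!: exI[of _ i0])
  have least: "\<tau> \<le> t" if "P t" for t
  proof -
    from that obtain i where i: "0 \<le> t" "d i \<le> t" by (auto simp: P_def d_def algebra_simps)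
    have "Min (range d) \<le> d i" by simp
    with i show ?thesis unfolding \<tau>_def by linarith
  qed
  have eq: "region_delay T (q, v) = \<tau>"
    unfolding region_delay_def case_prod_conv P_def[symmetric]
    using P least by (rule Least_equality)
  show "0 \<le> region_delay T (q, v)"
    and "\<exists>i. v i + region_delay T (q, v) \<ge> real (duration (T i) (q i))"
    using P unfolding eq P_def by auto
  show "region_delay T (q, v) \<le> t" if "0 \<le> t" "v i + t \<ge> real (duration (T i) (q i))"
    using least[of t] that unfolding eq P_def by auto
qed

lemma region_states_cases:
  fixes T :: "'i::finite \<Rightarrow> ('q, 'p) wts"
  assumes T: "\<And>i. weighted_transition_system AP (T i)"
  assumes "s \<in> region_states T"
  shows "s = region_initial \<or>
    (\<forall>i. fst s i \<noteq> DInit \<and> 0 \<le> snd s i \<and> snd s i < duration (T i) (fst s i))"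
  using assms(2)
proof induction
  case init
  then show ?case by simp
next
  case (step s s')
  obtain q v q' v' where s: "s = (q, v)" "s' = (q', v')" by (cases s, cases s')
  have new: "q' i \<noteq> DInit \<and> 0 < duration (T i) (q' i)"
    if "(q i, q' i) \<in> dual_transitions (T i)" for i
    using that T[of i] by (auto simp: dual_transitions_def weighted_transition_system_def)
  have init: "i \<in> region_expired T s" if "s = region_initial" for i
    using that region_delay_least(1)[of T q v] s
    by (auto simp: region_expired_def region_initial_def)
  have "q' i \<noteq> DInit \<and> 0 \<le> v' i \<and> v' i < duration (T i) (q' i)" for i
  proof (cases "i \<in> region_expired T s")
    case True
    then show ?thesis using step.hyps(2) new[of i] s by (auto simp: region_step_def)
  next
    case False
    then have "q i \<noteq> DInit \<and> 0 \<le> v i" using init step.IH s by auto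
    moreover have "q' i = q i \<and> v' i = v i + region_delay T (q, v)"
      using False step.hyps(2) s by (auto simp: region_step_def)
    moreover have "v i + region_delay T (q, v) < duration (T i) (q i)"
      using False s by (auto simp: region_expired_def)
    ultimately show ?thesis using region_delay_least(1)[of T q v] by auto
  qed
  then have "\<forall>i. fst s' i \<noteq> DInit \<and> 0 \<le> snd s' i \<and> snd s' i < duration (T i) (fst s' i)"
    using s by simp
  then show ?case by blast
qed

lemma region_label_eq:
  fixes T :: "'i::finite \<Rightarrow> ('q, 'p) wts"
  assumes T: "\<And>i. weighted_transition_system AP (T i)"
  assumes "(s, s') \<in> region_transitions T"
  shows "region_label T s' = region_step_label T s s'"
proof -
  have *: "region_step_label T s s' =
      (\<Union>i \<in> {i. snd s' i = 0}. dual_label (T i) (DInit, fst s' i))"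
    if "(s, s') \<in> region_transitions T" for s
  proof -
    obtain q v q' v' where s: "s = (q, v)" "s' = (q', v')" by (cases s, cases s')
    have st: "s \<in> region_states T" "region_step T s s'"
      using that by (auto simp: region_transitions_def)
    have "v' i \<noteq> 0" if i: "i \<notin> region_expired T s" for i
    proof -
      have ge: "0 \<le> region_delay T s" using region_delay_least(1) s by simp
      have "s \<noteq> region_initial"
        using i ge by (auto simp: region_expired_def region_initial_def)
      then have inv: "0 \<le> v j \<and> v j < duration (T j) (q j)" for j
        using region_states_cases[OF T st(1)] s by auto
      obtain j where "v j + region_delay T s \<ge> duration (T j) (q j)"
        using region_delay_least(2)[of T q v] s by auto
      with inv[of j] have "0 < region_delay T s" by linarith
      moreover have "v' i = v i + region_delay T s"
        using st(2) i s by (auto simp: region_step_def)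
      ultimately show ?thesis using inv[of i] by linarith
    qed
    moreover have "v' i = 0" if "i \<in> region_expired T s" for i
      using st(2) that s by (auto simp: region_step_def)
    ultimately have "region_expired T s = {i. snd s' i = 0}" using s by auto
    then show ?thesis by (simp add: region_step_label_def dual_label_def)
  qed
  show ?thesis
    unfolding region_label_def using *[OF assms(2)] * assms(2) by blast
qed

definition region_run ::
  "('i::finite \<Rightarrow> ('q, 'p) wts) \<Rightarrow> (nat \<Rightarrow> ('i, 'q) region_state) \<Rightarrow> bool" where
  "region_run T \<rho> \<longleftrightarrow>
     \<rho> 0 = region_initial \<and> (\<forall>k. (\<rho> k, \<rho> (Suc k)) \<in> region_transitions T)"

text \<open>Position \<open>k\<close> of the word and of the time sequence belongs to the state \<open>\<rho> (Suc k)\<close>: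
  the dummy initial state \<open>\<rho> 0\<close> is skipped.\<close>

definition region_word ::
  "('i::finite \<Rightarrow> ('q, 'p) wts) \<Rightarrow> (nat \<Rightarrow> ('i, 'q) region_state) \<Rightarrow> nat \<Rightarrow> 'p set" where
  "region_word T \<rho> k = region_label T (\<rho> (Suc k))"

definition region_time ::
  "('i::finite \<Rightarrow> ('q, 'p) wts) \<Rightarrow> (nat \<Rightarrow> ('i, 'q) region_state) \<Rightarrow> nat \<Rightarrow> real" where
  "region_time T \<rho> k = (\<Sum>j<Suc k. region_delay T (\<rho> j))"

definition region_cost ::
  "('i::finite \<Rightarrow> ('q, 'p) wts) \<Rightarrow> 'p \<Rightarrow> (nat \<Rightarrow> ('i, 'q) region_state) \<Rightarrow> ereal" where
  "region_cost T \<pi> \<rho> = cost \<pi> (region_word T \<rho>) (region_time T \<rho>)"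

text \<open>The specification of the subroutine Optimal-Run.\<close>

definition optimal_region_run ::
  "('i::finite \<Rightarrow> ('q, 'p) wts) \<Rightarrow> 'p \<Rightarrow> 'p ltl \<Rightarrow> (nat \<Rightarrow> ('i, 'q) region_state) \<Rightarrow> bool" where
  "optimal_region_run T \<pi> \<phi> \<rho> \<longleftrightarrow>
     region_run T \<rho> \<and> ltl_sat (region_word T \<rho>) \<phi> \<and>
     (\<forall>\<rho>'. region_run T \<rho>' \<and> ltl_sat (region_word T \<rho>') \<phi> \<longrightarrow>
        region_cost T \<pi> \<rho> \<le> region_cost T \<pi> \<rho>')"

text \<open>The \<open>k\<close>-th output is produced at the \<open>k\<close>-th position \<open>n \<ge> 1\<close> at which the clock of
  robot \<open>i\<close> is zero.\<close>

definition projection ::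
  "(nat \<Rightarrow> ('i, 'q) region_state) \<Rightarrow> 'i \<Rightarrow> nat \<Rightarrow> 'q" where
  "projection \<rho> i k = source (fst (\<rho> (enumerate {n. 1 \<le> n \<and> snd (\<rho> n) i = 0} k)) i)"

end

theory Submission
  imports Defs
begin

text \<open>
  Projection is a bijection from runs of the region automaton to tuples of robot runs: the
  inverse sends a tuple to the sequence of joint states at the successive team times, a robot
  that reached its \<open>j\<close>-th vertex last being in the dual state \<open>(r j, r (j + 1))\<close> with the time
  elapsed since then on its clock. Both words and both time sequences agree along this
  bijection, hence so do satisfaction of \<open>\<phi>\<close> and cost. That a projection is infinite rests on
  the weights being integers: every delay after the first is then at least \<open>1\<close>, so time
  diverges and each clock is reset infinitely often.
\<close>

section \<open>Arrival times and delays\<close>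

text \<open>Recognises a team time sequence: an increasing sequence is determined by its range, so
  comparing sets of arrival times is enough.\<close>

lemma strict_mono_enumerate_range:
  fixes f :: "nat \<Rightarrow> nat"
  assumes "strict_mono f"
  shows "enumerate (range f) = f"
proof
  fix n
  have inf: "infinite (range f)"
    using assms by (simp add: range_inj_infinite strict_mono_imp_inj_on)
  show "enumerate (range f) n = f n"
  proof (induction n)
    case 0
    show ?case unfolding enumerate_0
      using assms by (intro Least_equality) (auto simp: strict_mono_less_eq)
  next
    case (Suc n)
    show ?case unfolding enumerate_Suc''[OF inf] Suc.IH
      using assms by (intro Least_equality) (auto simp: strict_mono_less_eq strict_mono_less)
  qed
qed

lemma strict_mono_arrival:
  assumes "weighted_transition_system AP T" "is_run T r"
  shows "strict_mono (arrival T r)"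
  using assms by (auto simp: strict_mono_Suc_iff weighted_transition_system_def is_run_def)

declare arrival.simps(2) [simp del]

text \<open>Index of the last vertex reached by time \<open>x\<close>. The \<open>GREATEST\<close>
  is meaningful once arrival times increase strictly.\<close>

definition position :: "('q, 'p) wts \<Rightarrow> (nat \<Rightarrow> 'q) \<Rightarrow> nat \<Rightarrow> nat" where
  "position T r x = (GREATEST j. arrival T r j \<le> x)"

lemma position_bounds:
  assumes "strict_mono (arrival T r)"
  shows "arrival T r (position T r x) \<le> x" "x < arrival T r (Suc (position T r x))"
proof -
  \<comment> \<open>Strictly increasing naturals satisfy \<open>j \<le> arrival T r j\<close>, so
    the candidates are bounded; index 0, with arrival time 0, is always one of them.\<close>
  have bound: "j \<le> x" if "arrival T r j \<le> x" for j
    using strict_mono_imp_increasing[OF assms, of j] that by linarith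
  show "arrival T r (position T r x) \<le> x"
    unfolding position_def by (rule GreatestI_nat[of _ 0]) (use bound in auto)
  show "x < arrival T r (Suc (position T r x))"
  proof (rule ccontr)
    assume "\<not> x < arrival T r (Suc (position T r x))"
    then have "Suc (position T r x) \<le> position T r x"
      unfolding position_def by (intro Greatest_le_nat[where b = x]) (auto simp: bound)
    then show False by simp
  qed
qed

lemma position_eqI:
  assumes "strict_mono (arrival T r)"
    and "arrival T r j \<le> x" "x < arrival T r (Suc j)"
  shows "position T r x = j"
  using position_bounds[OF assms(1), of x] assms(2,3)
    strict_mono_less[OF assms(1), of j "Suc (position T r x)"]
    strict_mono_less[OF assms(1), of "position T r x" "Suc j"]
  by auto

text \<open>A certificate that avoids the \<open>LEAST\<close>: robot \<open>i\<close> is due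
  exactly after \<open>d\<close>, and no robot overshoots its duration by then.\<close>

lemma region_delay_eqI:
  fixes T :: "'i::finite \<Rightarrow> ('q, 'p) wts" and v :: "'i \<Rightarrow> real"
  assumes "0 \<le> d" "v i + d = duration (T i) (q i)" "\<And>i. v i + d \<le> duration (T i) (q i)"
  shows "region_delay T (q, v) = d"
proof (rule antisym)
  show "region_delay T (q, v) \<le> d"
    using assms by (intro region_delay_least(3)[of _ _ i]) auto
  obtain j where "duration (T j) (q j) \<le> v j + region_delay T (q, v)"
    using region_delay_least(2)[of T q v] by auto
  then show "d \<le> region_delay T (q, v)" using assms(3)[of j] by linarith
qed

lemma region_delay_le:
  fixes T :: "'i::finite \<Rightarrow> ('q, 'p) wts" and v :: "'i \<Rightarrow> real"
  assumes "v i \<le> duration (T i) (q i)"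
  shows "v i + region_delay T (q, v) \<le> duration (T i) (q i)"
  using region_delay_least(3)[of "duration (T i) (q i) - v i" T i q v] assms by linarith

section \<open>The region run of a tuple of runs\<close>

text \<open>State \<open>Suc k\<close> is the snapshot at team time \<open>k\<close>, since state 0
  is the dummy. A robot arriving exactly at that time already counts as being on its next edge, with
  clock 0.\<close>

definition team_region_run ::
  "('i::finite \<Rightarrow> ('q, 'p) wts) \<Rightarrow> ('i \<Rightarrow> nat \<Rightarrow> 'q) \<Rightarrow> nat \<Rightarrow> ('i, 'q) region_state" where
  "team_region_run T r n = (case n of 0 \<Rightarrow> region_initial | Suc k \<Rightarrow>
     (\<lambda>i. let j = position (T i) (r i) (team_time T r k) in DEdge (r i j) (r i (Suc j)),
      \<lambda>i. real (team_time T r k)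
            - real (arrival (T i) (r i) (position (T i) (r i) (team_time T r k)))))"

context
  fixes T :: "'i::finite \<Rightarrow> ('q, 'p) wts" and AP :: "'p set" and r :: "'i \<Rightarrow> nat \<Rightarrow> 'q"
  assumes T: "\<And>i. weighted_transition_system AP (T i)"
    and r: "\<And>i. is_run (T i) (r i)"
begin

private abbreviation "a i \<equiv> arrival (T i) (r i)"
private abbreviation "\<theta> \<equiv> team_time T r"
private abbreviation "pos i k \<equiv> position (T i) (r i) (\<theta> k)"

section \<open>Team times and positions of the robots\<close>

private lemma mono: "strict_mono (a i)"
  using strict_mono_arrival[OF T r] .

private lemma infinite_times: "infinite (\<Union>i. range (a i))"
proof -
  \<comment> \<open>\<open>undefined\<close> merely names some robot; one robot already contributes
    infinitely many times.\<close>
  have "infinite (range (a undefined))"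
    using mono by (simp add: range_inj_infinite strict_mono_imp_inj_on)
  then show ?thesis by (rule contrapos_nn) (auto elim: finite_subset[rotated])
qed

private lemma arrival_in_times: "\<exists>k. a i j = \<theta> k"
  using range_enumerate[OF infinite_times] unfolding team_time_def by blast

private lemma team_time_in: "\<exists>i j. a i j = \<theta> k"
  using enumerate_in_set[OF infinite_times, of k] unfolding team_time_def by (auto dest: sym)

private lemma team_time_strict_mono: "strict_mono \<theta>"
  unfolding team_time_def using strict_mono_enumerate[OF infinite_times] .

private lemma team_time_0: "\<theta> 0 = 0"
  using arrival_in_times[of undefined 0] strict_mono_less_eq[OF team_time_strict_mono, of 0]
  by (metis arrival.simps(1) le0 le_zero_eq)

private lemma pos_bounds: "a i (pos i k) \<le> \<theta> k" "\<theta> k < a i (Suc (pos i k))"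
  using position_bounds[OF mono] by auto

text \<open>The next arrival of a robot is itself a team time after
  \<open>\<theta> k\<close>.\<close>

private lemma next_arrival_ge: "\<theta> (Suc k) \<le> a i (Suc (pos i k))"
proof -
  obtain k' where k': "a i (Suc (pos i k)) = \<theta> k'" using arrival_in_times by blast
  then have "k < k'" using pos_bounds(2)[of k i] strict_mono_less[OF team_time_strict_mono] by simp
  then show ?thesis using k' strict_mono_less_eq[OF team_time_strict_mono, of "Suc k" k'] by simp
qed

text \<open>Some robot arrives at \<open>\<theta> (Suc k)\<close>, and by
  \<open>next_arrival_ge\<close> this must be its very next arrival. So the next team time is the
  minimum of the next arrivals, just as the region automaton chooses its delay.\<close>

private lemma next_arrival_attained: "\<exists>i. a i (Suc (pos i k)) = \<theta> (Suc k)"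
proof -
  obtain i j where ij: "a i j = \<theta> (Suc k)" using team_time_in by blast
  have "\<theta> k < a i j" using ij strict_mono_less[OF team_time_strict_mono] by simp
  then have "pos i k < j"
    using pos_bounds(1)[of i k] strict_mono_less[OF mono, of i "pos i k" j] by linarith
  then have "a i (Suc (pos i k)) \<le> a i j" using strict_mono_less_eq[OF mono] by simp
  then show ?thesis using ij next_arrival_ge[of k i] by (intro exI[of _ i]) linarith
qed

text \<open>A robot passes at most one vertex per team step: its next arrival is no earlier than
  \<open>\<theta> (Suc k)\<close>, and the one after that is strictly later.\<close>

private lemma pos_Suc:
  "pos i (Suc k) = (if a i (Suc (pos i k)) = \<theta> (Suc k) then Suc (pos i k) else pos i k)"
proof -
  have "\<theta> k < \<theta> (Suc k)" using strict_mono_less[OF team_time_strict_mono] by simp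
  then have "a i (pos i k) \<le> \<theta> (Suc k)" using pos_bounds(1)[of i k] by linarith
  moreover have "a i (Suc (pos i k)) < a i (Suc (Suc (pos i k)))"
    using strict_mono_less[OF mono] by simp
  ultimately show ?thesis
    using next_arrival_ge[of k i]
      position_eqI[OF mono[of i], of "pos i k" "\<theta> (Suc k)"]
      position_eqI[OF mono[of i], of "Suc (pos i k)" "\<theta> (Suc k)"]
    by (cases "a i (Suc (pos i k)) = \<theta> (Suc k)") simp_all
qed

private lemma position_0: "position (T i) (r i) 0 = 0"
  using strict_mono_less[OF mono, of i 0 "Suc 0"] by (intro position_eqI[OF mono]) auto

section \<open>Delays and expired clocks along the team's region run\<close>

private lemma team_delay_0: "region_delay T (team_region_run T r 0) = 0"
  unfolding team_region_run_def
  by (auto simp: region_initial_def intro!: region_delay_eqI[of _ _ undefined])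

private lemma team_delay_Suc:
  "region_delay T (team_region_run T r (Suc k)) = real (\<theta> (Suc k)) - real (\<theta> k)"
proof -
  obtain i where "a i (Suc (pos i k)) = \<theta> (Suc k)" using next_arrival_attained by blast
  moreover have "\<theta> k < \<theta> (Suc k)" using strict_mono_less[OF team_time_strict_mono] by simp
  moreover have "real (\<theta> (Suc k)) - real (a i (pos i k))
      \<le> weight (T i) (r i (pos i k)) (r i (Suc (pos i k)))" for i
    using next_arrival_ge[of k i] by (simp add: arrival.simps(2))
  ultimately show ?thesis
    unfolding team_region_run_def
    by (auto simp: Let_def arrival.simps(2) intro!: region_delay_eqI[of _ _ i])
qed

text \<open>With the delay known, the clock constraint reads
  \<open>a i (Suc (pos i k)) \<le> \<theta> (Suc k)\<close>; the reverse inequality always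
  holds.\<close>

private lemma team_expired_Suc:
  "i \<in> region_expired T (team_region_run T r (Suc k)) \<longleftrightarrow> a i (Suc (pos i k)) = \<theta> (Suc k)"
proof -
  have "i \<in> region_expired T (team_region_run T r (Suc k)) \<longleftrightarrow>
      real (a i (Suc (pos i k))) \<le> real (\<theta> (Suc k))"
    using team_delay_Suc[of k]
    by (auto simp: region_expired_def team_region_run_def Let_def arrival.simps(2))
  then show ?thesis using next_arrival_ge[of k i] by auto
qed

private lemma team_expired_0: "i \<in> region_expired T (team_region_run T r 0)"
  using team_delay_0 by (auto simp: region_expired_def team_region_run_def region_initial_def)

text \<open>The two cases of \<open>pos_Suc\<close> are the two clauses of
  \<open>region_step\<close>: expired robots advance one vertex and reset, the others stay and
  age.\<close>

private lemma region_step_team: "region_step T (team_region_run T r k) (team_region_run T r (Suc k))"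
proof (cases k)
  case 0
  have "(DInit, DEdge (r i 0) (r i (Suc 0))) \<in> dual_transitions (T i)" for i
    using r[of i] by (auto simp: dual_transitions_def is_run_def) metis
  then show ?thesis
    using team_expired_0 unfolding 0
    by (auto simp: region_step_def team_region_run_def region_initial_def Let_def position_0 team_time_0)
next
  case (Suc l)
  have "(DEdge (r i j) (r i (Suc j)), DEdge (r i (Suc j)) (r i (Suc (Suc j))))
      \<in> dual_transitions (T i)" for i j
    using r[of i] by (auto simp: dual_transitions_def is_run_def)
  then show ?thesis
    using team_expired_Suc[of _ l] team_delay_Suc[of l] pos_Suc[of _ l] unfolding Suc
    by (auto simp: region_step_def team_region_run_def Let_def)
qed

section \<open>Run property, times, word and cost\<close>

lemma region_run_team: "region_run T (team_region_run T r)"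
proof -
  have "team_region_run T r k \<in> region_states T" for k
  proof (induction k)
    case 0
    show ?case by (simp add: team_region_run_def region_states.init)
  next
    case (Suc k)
    then show ?case using region_step_team by (rule region_states.step)
  qed
  then show ?thesis
    using region_step_team by (simp add: region_run_def region_transitions_def team_region_run_def)
qed

text \<open>The delays telescope; the zero delay of the dummy state matches
  \<open>\<theta> 0 = 0\<close>.\<close>

lemma region_time_team: "region_time T (team_region_run T r) = (\<lambda>k. real (team_time T r k))"
proof
  fix k
  show "region_time T (team_region_run T r) k = real (team_time T r k)"
    by (induction k) (simp_all add: region_time_def team_delay_0 team_time_0 team_delay_Suc)
qed

lemma region_word_team: "region_word T (team_region_run T r) = team_word T r"
proof
  fix k
  \<comment> \<open>The robots whose clock expires when leaving state \<open>k\<close> are those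
    standing at a vertex at time \<open>\<theta> k\<close>.\<close>
  have *: "i \<in> region_expired T (team_region_run T r k) \<longleftrightarrow> a i (pos i k) = \<theta> k" for i
  proof (cases k)
    case 0
    then show ?thesis using team_expired_0 by (simp add: position_0 team_time_0)
  next
    case (Suc l)
    have "\<theta> l < \<theta> (Suc l)" using strict_mono_less[OF team_time_strict_mono] by simp
    then show ?thesis
      using team_expired_Suc[of i l] pos_Suc[of i l] pos_bounds(1)[of i l] unfolding Suc by auto
  qed
  \<comment> \<open>Strictness leaves only one index per robot, so the union over \<open>i\<close>
    and \<open>j\<close> collapses to one over \<open>i\<close>.\<close>
  have "pos i k = j" if "a i j = \<theta> k" for i j
    using that strict_mono_less[OF mono, of i j "Suc j"] by (intro position_eqI[OF mono]) auto
  then have "team_word T r k = (\<Union>i \<in> {i. a i (pos i k) = \<theta> k}. labelling (T i) (r i (pos i k)))"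
    unfolding team_word_def by blast
  also have "\<dots> = region_step_label T (team_region_run T r k) (team_region_run T r (Suc k))"
    using * by (auto simp: region_step_label_def dual_label_def team_region_run_def Let_def)
  also have "\<dots> = region_word T (team_region_run T r) k"
    using region_run_team unfolding region_word_def region_run_def
    by (intro region_label_eq[OF T, symmetric]) auto
  finally show "region_word T (team_region_run T r) k = team_word T r k" ..
qed

lemma region_cost_team: "region_cost T \<pi> (team_region_run T r) = team_cost T \<pi> r"
  unfolding region_cost_def team_cost_def region_word_team region_time_team ..

end

section \<open>Projections of region runs\<close>

text \<open>Clocks change only by resets and delays, and a delay is a duration minus the clock of an
  expiring robot. This later turns positive delays into delays of at least 1.\<close>

lemma region_states_clock_Ints:
  fixes T :: "'i::finite \<Rightarrow> ('q, 'p) wts"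
  assumes T: "\<And>i. weighted_transition_system AP (T i)"
  assumes "s \<in> region_states T"
  shows "(\<forall>i. snd s i \<in> \<int>) \<and> region_delay T s \<in> \<int>"
proof -
  have delay: "region_delay T s \<in> \<int>" if "s \<in> region_states T" "\<forall>i. snd s i \<in> \<int>" for s
  proof -
    obtain q v where s: "s = (q, v)" by (cases s)
    \<comment> \<open>Not strict, because clock and duration are both 0 in the initial
      state.\<close>
    have le: "v i \<le> duration (T i) (q i)" for i
      using region_states_cases[OF T that(1)] s by (auto simp: region_initial_def less_imp_le)
    obtain i where "v i + region_delay T s \<ge> duration (T i) (q i)"
      using region_delay_least(2)[of T q v] s by auto
    then have "region_delay T s = duration (T i) (q i) - v i"
      using region_delay_le[of v i T q, OF le] s by simp
    then show ?thesis using that(2) s by auto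
  qed
  show ?thesis
    using assms(2)
  proof induction
    case init
    then show ?case by (intro conjI delay region_states.init) (auto simp: region_initial_def)
  next
    case (step s s')
    have "snd s' i \<in> \<int>" for i
      using step.hyps(2) step.IH
      by (cases s; cases s'; cases "i \<in> region_expired T s") (auto simp: region_step_def)
    then show ?case using region_states.step[OF step.hyps] delay by blast
  qed
qed

context
  fixes T :: "'i::finite \<Rightarrow> ('q, 'p) wts" and AP :: "'p set"
    and \<rho> :: "nat \<Rightarrow> ('i, 'q) region_state"
  assumes T: "\<And>i. weighted_transition_system AP (T i)"
    and \<rho>: "region_run T \<rho>"
begin

text \<open>Time at which state \<open>n\<close> is entered; \<open>t (Suc k)\<close> is
  \<open>region_time T \<rho> k\<close>.\<close>

private definition t :: "nat \<Rightarrow> real" where "t n = (\<Sum>j<n. region_delay T (\<rho> j))"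
private definition Z :: "'i \<Rightarrow> nat set" where "Z i = {n. 1 \<le> n \<and> snd (\<rho> n) i = 0}"
private abbreviation "z i \<equiv> enumerate (Z i)"
private abbreviation "expired n \<equiv> region_expired T (\<rho> n)"

section \<open>Delays and resets along a region run\<close>

private lemma run_0: "\<rho> 0 = region_initial"
  and run_states: "\<rho> n \<in> region_states T"
  and run_step: "region_step T (\<rho> n) (\<rho> (Suc n))"
  using \<rho> by (auto simp: region_run_def region_transitions_def)

private lemma t_Suc: "t (Suc n) = t n + region_delay T (\<rho> n)"
  by (simp add: t_def)

private lemma step_expired:
  assumes "i \<in> expired n"
  shows "(fst (\<rho> n) i, fst (\<rho> (Suc n)) i) \<in> dual_transitions (T i)" "snd (\<rho> (Suc n)) i = 0"
  using run_step[of n] assms by (cases "\<rho> n"; cases "\<rho> (Suc n)"; auto simp: region_step_def)+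

private lemma step_not_expired:
  assumes "i \<notin> expired n"
  shows "fst (\<rho> (Suc n)) i = fst (\<rho> n) i"
    and "snd (\<rho> (Suc n)) i = snd (\<rho> n) i + region_delay T (\<rho> n)"
  using run_step[of n] assms by (cases "\<rho> n"; cases "\<rho> (Suc n)"; auto simp: region_step_def)+

private lemma expired_0: "i \<in> expired 0" and delay_0: "region_delay T (\<rho> 0) = 0"
proof -
  show "region_delay T (\<rho> 0) = 0"
    unfolding run_0 region_initial_def by (rule region_delay_eqI[of _ _ undefined]) auto
  then show "i \<in> expired 0"
    by (auto simp: run_0 region_expired_def region_initial_def)
qed

text \<open>No dual transition ends in \<open>DInit\<close>. This excludes the exceptional case of
  \<open>region_states_cases\<close>, giving strict clock bounds.\<close>

private lemma not_initial:
  assumes "0 < n" shows "\<rho> n \<noteq> region_initial"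
proof -
  obtain k where n: "n = Suc k" using assms by (cases n) auto
  have "fst (\<rho> (Suc k)) i \<noteq> DInit" for i
  proof (induction k)
    case 0
    show ?case using step_expired(1)[OF expired_0, of i] by (auto simp: dual_transitions_def)
  next
    case (Suc k)
    then show ?case
      using step_expired(1)[of i "Suc k"] step_not_expired(1)[of i "Suc k"]
      by (cases "i \<in> expired (Suc k)") (auto simp: dual_transitions_def)
  qed
  then show ?thesis unfolding n by (auto simp: region_initial_def dest: arg_cong[of _ _ fst])
qed

private lemma clock_bounds:
  assumes "0 < n" shows "0 \<le> snd (\<rho> n) i" "snd (\<rho> n) i < duration (T i) (fst (\<rho> n) i)"
  using region_states_cases[OF T run_states[of n]] not_initial[OF assms] by auto

private lemma expired_clock:
  assumes "0 < n" "i \<in> expired n"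
  shows "snd (\<rho> n) i + region_delay T (\<rho> n) = duration (T i) (fst (\<rho> n) i)"
  using assms(2) clock_bounds(2)[OF assms(1), of i]
    region_delay_le[of "snd (\<rho> n)" i T "fst (\<rho> n)"]
  by (auto simp: region_expired_def split_def)

private lemma ex_expired: "\<exists>i. i \<in> expired n"
  using region_delay_least(2)[of T "fst (\<rho> n)" "snd (\<rho> n)"]
  by (auto simp: region_expired_def split_def)

text \<open>An expiring clock was strictly below its duration, so the delay is positive, and it is
  an integer.\<close>

private lemma delay_ge_1:
  assumes "0 < n" shows "1 \<le> region_delay T (\<rho> n)"
proof -
  obtain i where "i \<in> expired n" using ex_expired by blast
  then have "0 < region_delay T (\<rho> n)"
    using expired_clock[OF assms] clock_bounds(2)[OF assms, of i] by fastforce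
  moreover have "region_delay T (\<rho> n) \<in> \<int>"
    using region_states_clock_Ints[OF T run_states] by blast
  ultimately show ?thesis by (auto elim!: Ints_cases)
qed

text \<open>A zero clock can only come from a reset: a clock that is not reset has just grown by a
  delay of at least 1.\<close>

private lemma Z_Suc: "Suc n \<in> Z i \<longleftrightarrow> i \<in> expired n"
proof
  assume Z: "Suc n \<in> Z i"
  show "i \<in> expired n"
  proof (rule ccontr)
    assume not: "i \<notin> expired n"
    with expired_0 have "0 < n" by (cases n) auto
    then show False
      using Z step_not_expired(2)[OF not] clock_bounds(1)[of n i] delay_ge_1[of n]
      by (simp add: Z_def)
  qed
qed (simp add: Z_def step_expired)

text \<open>Without further resets a robot would stay on one edge while its clock grows by at least
  1 per step, eventually reaching the edge's duration.\<close>

private lemma infinite_Z: "infinite (Z i)"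
proof
  assume "finite (Z i)"
  then obtain N where N: "\<And>n. n \<in> Z i \<Longrightarrow> n \<le> N"
    unfolding finite_nat_set_iff_bounded_le by blast
  define q where "q = fst (\<rho> (Suc N)) i"
  have not: "i \<notin> expired (Suc N + n)" for n
  proof
    assume "i \<in> expired (Suc N + n)"
    then have "Suc (Suc N + n) \<in> Z i" unfolding Z_Suc .
    then show False using N[of "Suc (Suc N + n)"] by simp
  qed
  have stay: "fst (\<rho> (Suc N + n)) i = q \<and> real n \<le> snd (\<rho> (Suc N + n)) i" for n
  proof (induction n)
    case 0
    show ?case using clock_bounds(1)[of "Suc N" i] by (simp add: q_def)
  next
    case (Suc n)
    then show ?case
      using step_not_expired[OF not[of n]] delay_ge_1[of "Suc N + n"] by simp
  qed
  define n where "n = duration (T i) q"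
  have "snd (\<rho> (Suc N + n)) i < duration (T i) q"
    using clock_bounds(2)[of "Suc N + n" i] stay[of n] by simp
  then show False using stay[of n] by (simp add: n_def)
qed

section \<open>Windows between consecutive resets\<close>

private lemma z_in: "z i j \<in> Z i"
  by (rule enumerate_in_set[OF infinite_Z])

private lemma z_0: "z i 0 = 1"
  unfolding enumerate_0
  using Z_Suc[of 0 i] expired_0 by (intro Least_equality) (auto simp: Z_def)

private lemma z_mono: "z i j < z i (Suc j)"
  by (rule enumerate_step[OF infinite_Z])

private lemma Z_gap:
  assumes "n \<in> Z i" "z i j < n" shows "z i (Suc j) \<le> n"
  unfolding enumerate_Suc''[OF infinite_Z] using assms by (intro Least_le) auto

text \<open>No reset occurs strictly inside the window, so the edge is frozen and the clock shows
  the time elapsed since the window began.\<close>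

private lemma between:
  assumes "z i j \<le> n" "n < z i (Suc j)"
  shows "fst (\<rho> n) i = fst (\<rho> (z i j)) i \<and> snd (\<rho> n) i = t n - t (z i j)"
  using assms
proof (induction n rule: dec_induct)
  case base
  show ?case using z_in[of i j] by (simp add: Z_def)
next
  case (step n)
  then have "i \<notin> expired n" using Z_gap[of "Suc n" i j] Z_Suc by fastforce
  then show ?case using step step_not_expired by (simp add: t_Suc)
qed

private lemma ex_between:
  assumes "1 \<le> n" shows "\<exists>j. z i j \<le> n \<and> n < z i (Suc j)"
  using assms
proof (induction n rule: dec_induct)
  case base
  show ?case using z_0[of i] z_mono[of i 0] by (intro exI[of _ 0]) simp
next
  case (step n)
  then obtain j where "z i j \<le> n" "n < z i (Suc j)" by blast
  then have "z i j \<le> Suc n \<and> Suc n < z i (Suc j) \<or>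
      z i (Suc j) \<le> Suc n \<and> Suc n < z i (Suc (Suc j))"
    using z_mono[of i "Suc j"] by linarith
  then show ?case by blast
qed

private lemma consecutive:
  "(fst (\<rho> (z i j)) i, fst (\<rho> (z i (Suc j))) i) \<in> dual_transitions (T i)"
  "t (z i (Suc j)) = t (z i j) + duration (T i) (fst (\<rho> (z i j)) i)"
proof -
  \<comment> \<open>\<open>n\<close> is the last position of the window: \<open>between\<close>
    still describes it, and the clock reaches its duration on leaving it.\<close>
  obtain n where n: "z i (Suc j) = Suc n" using z_mono[of i j] by (cases "z i (Suc j)") auto
  have e: "i \<in> expired n" using z_in[of i "Suc j"] Z_Suc n by simp
  have b: "z i j \<le> n" "n < z i (Suc j)" using n z_mono[of i j] by auto
  have "0 < n" using b z_in[of i j] by (auto simp: Z_def)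
  then show "t (z i (Suc j)) = t (z i j) + duration (T i) (fst (\<rho> (z i j)) i)"
    using expired_clock[OF _ e] between[OF b] by (simp add: n t_Suc)
  show "(fst (\<rho> (z i j)) i, fst (\<rho> (z i (Suc j))) i) \<in> dual_transitions (T i)"
    using step_expired(1)[OF e] between[OF b] by (simp add: n)
qed

section \<open>The projected run and its arrival times\<close>

private lemma projection_eq: "projection \<rho> i j = source (fst (\<rho> (z i j)) i)"
  by (simp add: projection_def Z_def)

private lemma dual_transition_0: "(DInit, fst (\<rho> (z i 0)) i) \<in> dual_transitions (T i)"
  using step_expired(1)[OF expired_0, of i] by (simp add: z_0 run_0 region_initial_def)

private lemma state_not_DInit: "fst (\<rho> (z i j)) i \<noteq> DInit"
proof -
  have "\<exists>q. (q, fst (\<rho> (z i j)) i) \<in> dual_transitions (T i)"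
    using dual_transition_0[of i] consecutive(1)[of i] by (cases j) blast+
  then show ?thesis by (auto simp: dual_transitions_def)
qed

text \<open>Projection keeps only sources but loses nothing: dual transitions glue edges, so the
  target of an edge is the source of the next.\<close>

private lemma state_eq:
  "fst (\<rho> (z i j)) i = DEdge (projection \<rho> i j) (projection \<rho> i (Suc j))"
proof -
  have "q = DEdge (source q) (source q')"
    if "(q, q') \<in> dual_transitions (T i)" "q \<noteq> DInit" for q q'
    using that by (cases q; cases q') (auto simp: dual_transitions_def)
  from this[OF consecutive(1) state_not_DInit] show ?thesis unfolding projection_eq .
qed

lemma is_run_projection: "is_run (T i) (projection \<rho> i)"
proof -
  have "projection \<rho> i 0 = initial (T i)"
    using dual_transition_0[of i] unfolding projection_eq by (auto simp: dual_transitions_def)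
  moreover have "(projection \<rho> i j, projection \<rho> i (Suc j)) \<in> transitions (T i)" for j
    using consecutive(1)[of i j] by (auto simp: state_eq dual_transitions_def)
  ultimately show ?thesis by (simp add: is_run_def)
qed

private abbreviation "arr i \<equiv> arrival (T i) (projection \<rho> i)"

private lemma t_z: "t (z i j) = real (arr i j)"
proof (induction j)
  case 0
  show ?case by (simp add: z_0 t_def delay_0)
next
  case (Suc j)
  then show ?case using consecutive(2)[of i j] by (simp add: state_eq arrival.simps(2))
qed

private lemma team_time_projection: "real (team_time T (projection \<rho>) k) = t (Suc k)"
proof -
  \<comment> \<open>The floor is exact: each position \<open>Suc k\<close> is a reset of some robot,
    so by \<open>t_z\<close> its time is an arrival time, a natural number.\<close>
  define f where "f k = nat \<lfloor>t (Suc k)\<rfloor>" for k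
  have ex: "\<exists>i j. Suc k = z i j" for k
  proof -
    obtain i where "Suc k \<in> Z i" using ex_expired Z_Suc by blast
    then show ?thesis using range_enumerate[OF infinite_Z[of i]] by blast
  qed
  have f: "real (f k) = t (Suc k)" for k
    using ex[of k] t_z unfolding f_def by auto
  have "real (f k) < real (f (Suc k))" for k
    using delay_ge_1[of "Suc k"] by (simp add: f t_Suc)
  then have "strict_mono f" by (simp add: strict_mono_Suc_iff)
  moreover have "range f = (\<Union>i. range (arr i))"
  proof (intro subset_antisym subsetI)
    fix x assume "x \<in> range f"
    then obtain k where k: "x = f k" by blast
    obtain i j where "Suc k = z i j" using ex by blast
    then have "real x = real (arr i j)" using f[of k] k t_z by simp
    then show "x \<in> (\<Union>i. range (arr i))" by auto
  next
    fix x assume "x \<in> (\<Union>i. range (arr i))"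
    then obtain i j where x: "x = arr i j" by blast
    obtain k where "z i j = Suc k" using z_in[of i j] by (cases "z i j") (auto simp: Z_def)
    then have "real x = real (f k)" using f[of k] t_z[of i j] x by simp
    then show "x \<in> range f" by auto
  qed
  ultimately have "team_time T (projection \<rho>) = f"
    unfolding team_time_def using strict_mono_enumerate_range by metis
  then show ?thesis using f by simp
qed

lemma team_region_run_projection: "team_region_run T (projection \<rho>) = \<rho>"
proof
  fix n
  show "team_region_run T (projection \<rho>) n = \<rho> n"
  proof (cases n)
    case 0
    then show ?thesis by (simp add: team_region_run_def run_0)
  next
    case (Suc k)
    \<comment> \<open>\<open>0 < m\<close> matters: the dummy state has delay 0, so
      \<open>t 0 = t 1\<close>.\<close>
    have t_less: "t m < t n" if "0 < m" "m < n" for m n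
      using that(2)
    proof (induction n)
      case (Suc n)
      then show ?case using that(1) delay_ge_1[of n] by (cases "m = n") (auto simp: t_Suc)
    qed simp
    let ?x = "team_time T (projection \<rho>) k"
    have "DEdge (projection \<rho> i (position (T i) (projection \<rho> i) ?x))
              (projection \<rho> i (Suc (position (T i) (projection \<rho> i) ?x))) = fst (\<rho> n) i
        \<and> real ?x - real (arr i (position (T i) (projection \<rho> i) ?x)) = snd (\<rho> n) i" for i
    proof -
      \<comment> \<open>The reset window containing \<open>n\<close> becomes, in times, the interval
        between arrivals \<open>j\<close> and \<open>Suc j\<close>, which pins down the
        position.\<close>
      obtain j where j: "z i j \<le> n" "n < z i (Suc j)" using ex_between[of n i] Suc by auto
      have "real (arr i j) \<le> real ?x" "real ?x < real (arr i (Suc j))"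
        using j z_in[of i j] unfolding team_time_projection t_z[symmetric] Suc[symmetric]
        by (auto simp: Z_def le_less intro: t_less)
      then have "position (T i) (projection \<rho> i) ?x = j"
        by (intro position_eqI strict_mono_arrival[OF T is_run_projection]) auto
      then show ?thesis
        using between[OF j] by (simp add: state_eq team_time_projection t_z Suc)
    qed
    then show ?thesis by (simp add: Suc team_region_run_def Let_def prod_eq_iff fun_eq_iff)
  qed
qed

end

section \<open>Transfer of optimality\<close>

theorem mainTheorem1:
  fixes T :: "'i::finite \<Rightarrow> ('q, 'p) wts"
    and AP :: "'p set"
    and \<pi> :: 'p
    and \<psi> \<phi> :: "'p ltl"
    and \<rho> :: "nat \<Rightarrow> ('i, 'q) region_state"
    and r_opt :: "'i \<Rightarrow> nat \<Rightarrow> 'q"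
  assumes "\<And>i. weighted_transition_system AP (T i)"
    and "\<pi> \<in> AP"
    and "ltl_atoms \<psi> \<subseteq> AP"
    and "\<phi> = LAnd \<psi> (LAlways (LEventually (LProp \<pi>)))"
    and "optimal_region_run T \<pi> \<phi> \<rho>"
    and "r_opt = projection \<rho>"
  shows "(\<forall>i. is_run (T i) (r_opt i)) \<and>
    ltl_sat (team_word T r_opt) \<phi> \<and>
    (\<forall>r. (\<forall>i. is_run (T i) (r i)) \<and> ltl_sat (team_word T r) \<phi> \<longrightarrow>
      team_cost T \<pi> r_opt \<le> team_cost T \<pi> r)"
proof -
  note T = assms(1)
  have run: "region_run T \<rho>" and sat: "ltl_sat (region_word T \<rho>) \<phi>"
    and opt: "\<And>\<rho>'. region_run T \<rho>' \<Longrightarrow> ltl_sat (region_word T \<rho>') \<phi> \<Longrightarrow>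
      region_cost T \<pi> \<rho> \<le> region_cost T \<pi> \<rho>'"
    using assms(5) by (auto simp: optimal_region_run_def)
  have r_opt: "is_run (T i) (r_opt i)" for i
    unfolding assms(6) using is_run_projection[OF T run] .
  \<comment> \<open>The returned run is the team run of its own projection, so the word and cost
    identities for team runs apply to it.\<close>
  have \<rho>: "team_region_run T r_opt = \<rho>"
    unfolding assms(6) using team_region_run_projection[OF T run] .
  \<comment> \<open>A competing tuple yields a region run with the same word and cost, against which
    \<open>\<rho>\<close> is optimal.\<close>
  have "team_cost T \<pi> r_opt \<le> team_cost T \<pi> r"
    if r: "\<And>i. is_run (T i) (r i)" and "ltl_sat (team_word T r) \<phi>" for r
    using opt[OF region_run_team[of AP T r, OF T r]] that(2) region_cost_team[of AP T r_opt \<pi>, OF T r_opt]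
    unfolding region_word_team[of AP T r, OF T r] region_cost_team[of AP T r, OF T r] \<rho> by simp
  moreover have "ltl_sat (team_word T r_opt) \<phi>"
    using sat region_word_team[of AP T r_opt, OF T r_opt] unfolding \<rho> by simp
  ultimately show ?thesis using r_opt by blast
qed

end
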